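(* Let $\mathcal C$ be an essentially small category. Let $J$ be a "notion of covering sieve" (a collection of sieves on objects of $\mathcal C$, whose elements are called $J$-covering) which is stable in the sense that: - every sieve which contains a covering sieve (or is maximal) is covering; - for every morphism $x:X'\to X$ of $\mathcal C$ and every covering sieve $C$ on $X$, the pullback $x^*C$ is a covering sieve on $X'$. Then a sieve $C\hookrightarrow y(X)$ on an object $X$ of $\mathcal C$ is an element of the topology $\overline J$ generated by $J$ if and only if the maximal sieve on $X$ is the unique sieve $C'\hookrightarrow y(X)$ satisfying the two following conditions: - $C'$ contains $C$; - $C'$ is $J$-closed, in the sense that a morphism $x:X'\to X$ is an element of $C'$ as soon as the sieve on $X'$ $$\{X''\xrightarrow{x'}X'\mid(x\circ x':X''\to X)\in C'\}$$ is $J$-covering.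
   Context: A sieve on $X$ is a sub-presheaf $C$ of $y(X)={\rm Hom}(\bullet,X)$, i.e. a collection of morphisms with target $X$ stable under precomposition; $x^*C=\{x':X''\to X'\mid x\circ x'\in C\}$. The topology generated by $J$ is the smallest Grothendieck topology on $\mathcal C$ containing all the sieves in $J$. *)

theory Defs
  imports Main
begin

section \<open>Categories\<close>

record ('o, 'm) cat =
  Obj :: "'o set"
  Arr :: "'m set"
  Dom :: "'m \<Rightarrow> 'o"
  Cod :: "'m \<Rightarrow> 'o"
  Id :: "'o \<Rightarrow> 'm"
  Comp :: "'m \<Rightarrow> 'm \<Rightarrow> 'm"  \<comment> \<open>\<open>Comp C g f\<close> is \<open>g \<circ> f\<close>\<close>

definition hom :: "('o, 'm) cat \<Rightarrow> 'o \<Rightarrow> 'o \<Rightarrow> 'm set" where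
  "hom C X Y = {f \<in> Arr C. Dom C f = X \<and> Cod C f = Y}"

locale category =
  fixes C :: "('o, 'm) cat"
  assumes dom_in_Obj: "f \<in> Arr C \<Longrightarrow> Dom C f \<in> Obj C"
    and cod_in_Obj: "f \<in> Arr C \<Longrightarrow> Cod C f \<in> Obj C"
    and id_in_hom: "X \<in> Obj C \<Longrightarrow> Id C X \<in> hom C X X"
    and comp_in_hom: "f \<in> hom C X Y \<Longrightarrow> g \<in> hom C Y Z \<Longrightarrow> Comp C g f \<in> hom C X Z"
    and comp_id_left: "f \<in> hom C X Y \<Longrightarrow> Comp C (Id C Y) f = f"
    and comp_id_right: "f \<in> hom C X Y \<Longrightarrow> Comp C f (Id C X) = f"
    and comp_assoc: "f \<in> hom C W X \<Longrightarrow> g \<in> hom C X Y \<Longrightarrow> h \<in> hom C Y Z \<Longrightarrow>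
      Comp C h (Comp C g f) = Comp C (Comp C h g) f"

definition is_functor ::
  "('o, 'm) cat \<Rightarrow> ('p, 'n) cat \<Rightarrow> ('o \<Rightarrow> 'p) \<Rightarrow> ('m \<Rightarrow> 'n) \<Rightarrow> bool" where
  "is_functor C D Fo Fa \<longleftrightarrow>
     (\<forall>X \<in> Obj C. Fo X \<in> Obj D) \<and>
     (\<forall>X Y. \<forall>f \<in> hom C X Y. Fa f \<in> hom D (Fo X) (Fo Y)) \<and>
     (\<forall>X \<in> Obj C. Fa (Id C X) = Id D (Fo X)) \<and>
     (\<forall>X Y Z. \<forall>f \<in> hom C X Y. \<forall>g \<in> hom C Y Z. Fa (Comp C g f) = Comp D (Fa g) (Fa f))"

definition is_iso :: "('o, 'm) cat \<Rightarrow> 'o \<Rightarrow> 'o \<Rightarrow> 'm \<Rightarrow> bool" where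
  "is_iso C X Y f \<longleftrightarrow> f \<in> hom C X Y \<and>
     (\<exists>g \<in> hom C Y X. Comp C g f = Id C X \<and> Comp C f g = Id C Y)"

definition is_nat_iso ::
  "('o, 'm) cat \<Rightarrow> ('p, 'n) cat \<Rightarrow> ('o \<Rightarrow> 'p) \<Rightarrow> ('m \<Rightarrow> 'n) \<Rightarrow> ('o \<Rightarrow> 'p) \<Rightarrow> ('m \<Rightarrow> 'n) \<Rightarrow>
   ('o \<Rightarrow> 'n) \<Rightarrow> bool" where
  "is_nat_iso C D Fo Fa Go Ga \<eta> \<longleftrightarrow>
     (\<forall>X \<in> Obj C. is_iso D (Fo X) (Go X) (\<eta> X)) \<and>
     (\<forall>X Y. \<forall>f \<in> hom C X Y. Comp D (\<eta> Y) (Fa f) = Comp D (Ga f) (\<eta> X))"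

definition equivalent_categories :: "('o, 'm) cat \<Rightarrow> ('p, 'n) cat \<Rightarrow> bool" where
  "equivalent_categories C D \<longleftrightarrow> (\<exists>Fo Fa Go Ga \<eta> \<epsilon>.
     is_functor C D Fo Fa \<and> is_functor D C Go Ga \<and>
     is_nat_iso C C id id (Go \<circ> Fo) (Ga \<circ> Fa) \<eta> \<and>
     is_nat_iso D D (Fo \<circ> Go) (Fa \<circ> Ga) id id \<epsilon>)"

text \<open>HOL has no notion of proper class, so size is measured against a type \<open>'u\<close>: a category is
  small if its objects and its morphisms are elements of \<open>'u\<close>, and essentially small if it is
  equivalent to a small one. The types of objects and of morphisms of \<open>C\<close> itself are unrelated
  to \<open>'u\<close>.\<close>

definition essentially_small :: "'u itself \<Rightarrow> ('o, 'm) cat \<Rightarrow> bool" where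
  "essentially_small U C \<longleftrightarrow>
     (\<exists>D :: ('u, 'u) cat. category D \<and> equivalent_categories C D)"


section \<open>Sieves and Grothendieck topologies\<close>

definition is_sieve :: "('o, 'm) cat \<Rightarrow> 'o \<Rightarrow> 'm set \<Rightarrow> bool" where
  "is_sieve C X S \<longleftrightarrow> X \<in> Obj C \<and>
     (\<forall>x \<in> S. x \<in> Arr C \<and> Cod C x = X) \<and>
     (\<forall>x \<in> S. \<forall>x' \<in> Arr C. Cod C x' = Dom C x \<longrightarrow> Comp C x x' \<in> S)"

definition max_sieve :: "('o, 'm) cat \<Rightarrow> 'o \<Rightarrow> 'm set" where
  "max_sieve C X = {x \<in> Arr C. Cod C x = X}"

definition pullback :: "('o, 'm) cat \<Rightarrow> 'm \<Rightarrow> 'm set \<Rightarrow> 'm set" where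
  "pullback C x S = {x' \<in> Arr C. Cod C x' = Dom C x \<and> Comp C x x' \<in> S}"

text \<open>In a collection of sieves each sieve is paired with its object, which the set of morphisms
  alone does not determine: the empty sieve is a sieve on every object.\<close>

definition sieves :: "('o, 'm) cat \<Rightarrow> ('o \<times> 'm set) set" where
  "sieves C = {(X, S). is_sieve C X S}"

definition grothendieck_topology :: "('o, 'm) cat \<Rightarrow> ('o \<times> 'm set) set \<Rightarrow> bool" where
  "grothendieck_topology C T \<longleftrightarrow> T \<subseteq> sieves C \<and>
     (\<forall>X \<in> Obj C. (X, max_sieve C X) \<in> T) \<and>
     (\<forall>X S. (X, S) \<in> T \<longrightarrow> (\<forall>X'. \<forall>x \<in> hom C X' X. (X', pullback C x S) \<in> T)) \<and>
     (\<forall>X S S'. (X, S) \<in> T \<longrightarrow> is_sieve C X S' \<longrightarrow>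
        (\<forall>x \<in> S. (Dom C x, pullback C x S') \<in> T) \<longrightarrow> (X, S') \<in> T)"

definition generated_topology ::
  "('o, 'm) cat \<Rightarrow> ('o \<times> 'm set) set \<Rightarrow> ('o \<times> 'm set) set" where
  "generated_topology C J = \<Inter> {T. grothendieck_topology C T \<and> J \<subseteq> T}"

definition closed_sieve ::
  "('o, 'm) cat \<Rightarrow> ('o \<times> 'm set) set \<Rightarrow> 'o \<Rightarrow> 'm set \<Rightarrow> bool" where
  "closed_sieve C J X S \<longleftrightarrow>
     (\<forall>X'. \<forall>x \<in> hom C X' X. (X', pullback C x S) \<in> J \<longrightarrow> x \<in> S)"


subsection \<open>The generated topology is the smallest topology containing \<open>J\<close>\<close>

context category
begin

lemma is_sieve_max: "X \<in> Obj C \<Longrightarrow> is_sieve C X (max_sieve C X)"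
  using comp_in_hom[unfolded hom_def] by (auto simp: is_sieve_def max_sieve_def)

lemma is_sieve_pullback:
  assumes S: "is_sieve C X S" and x: "x \<in> hom C X' X"
  shows "is_sieve C X' (pullback C x S)"
proof -
  have "Comp C x' x'' \<in> pullback C x S"
    if x': "x' \<in> pullback C x S" and x'': "x'' \<in> Arr C" "Cod C x'' = Dom C x'" for x' x''
  proof -
    have h: "x' \<in> hom C (Dom C x') X'" "x'' \<in> hom C (Dom C x'') (Dom C x')"
      using x x' x'' by (auto simp: pullback_def hom_def)
    have c: "Comp C x x' \<in> S" "Comp C x x' \<in> hom C (Dom C x') X"
      using x' comp_in_hom[OF h(1) x] by (auto simp: pullback_def)
    have "Comp C (Comp C x x') x'' \<in> S"
      using S c x'' by (auto simp: is_sieve_def hom_def)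
    then show ?thesis
      using comp_assoc[OF h(2,1) x] comp_in_hom[OF h(2,1)] x by (auto simp: pullback_def hom_def)
  qed
  then show ?thesis
    using x dom_in_Obj unfolding is_sieve_def by (auto simp: hom_def pullback_def)
qed

lemma grothendieck_topology_sieves: "grothendieck_topology C (sieves C)"
  unfolding grothendieck_topology_def sieves_def
  using is_sieve_max is_sieve_pullback by auto

lemma grothendieck_topology_generated:
  assumes "J \<subseteq> sieves C"
  shows "grothendieck_topology C (generated_topology C J)"
proof -
  have "generated_topology C J \<subseteq> sieves C"
    using grothendieck_topology_sieves assms by (auto simp: generated_topology_def)
  moreover have "(X, max_sieve C X) \<in> generated_topology C J" if "X \<in> Obj C" for X
    using that by (auto simp: generated_topology_def grothendieck_topology_def)
  moreover have "(X', pullback C x S) \<in> generated_topology C J"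
    if "(X, S) \<in> generated_topology C J" "x \<in> hom C X' X" for X X' x S
    unfolding generated_topology_def
  proof
    fix T assume "T \<in> {T. grothendieck_topology C T \<and> J \<subseteq> T}"
    then have "grothendieck_topology C T" and "(X, S) \<in> T"
      using that(1) by (auto simp: generated_topology_def)
    then show "(X', pullback C x S) \<in> T"
      using that(2) unfolding grothendieck_topology_def by blast
  qed
  moreover have "(X, S') \<in> generated_topology C J"
    if *: "(X, S) \<in> generated_topology C J" "is_sieve C X S'"
      "\<forall>x \<in> S. (Dom C x, pullback C x S') \<in> generated_topology C J" for X S S'
    unfolding generated_topology_def
  proof
    fix T assume "T \<in> {T. grothendieck_topology C T \<and> J \<subseteq> T}"
    then have T: "grothendieck_topology C T" and "generated_topology C J \<subseteq> T"
      by (auto simp: generated_topology_def)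
    then have "(X, S) \<in> T" "\<forall>x \<in> S. (Dom C x, pullback C x S') \<in> T"
      using * by auto
    then show "(X, S') \<in> T"
      using T *(2) unfolding grothendieck_topology_def by blast
  qed
  ultimately show ?thesis
    unfolding grothendieck_topology_def by blast
qed

end

lemma generated_topology_contains: "J \<subseteq> generated_topology C J"
  by (auto simp: generated_topology_def)

lemma generated_topology_least:
  "grothendieck_topology C T \<Longrightarrow> J \<subseteq> T \<Longrightarrow> generated_topology C J \<subseteq> T"
  by (auto simp: generated_topology_def)

end

theory Submission
  imports Defs
begin

text \<open>
  Call a sieve \<open>S\<close> on \<open>X\<close> dense when the only \<open>J\<close>-closed sieve containing it is the maximal one.
  The theorem says that the dense sieves are exactly the members of the generated topology.

  If \<open>S\<close> is dense, consider the sieve of all \<open>x\<close> such that \<open>x\<^sup>*S\<close> lies in the generated topology.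
  It contains \<open>S\<close>, and transitivity of the topology makes it \<open>J\<close>-closed, so it is
  maximal; that it contains the identity means that \<open>S\<close> itself lies in the topology
  (\<open>dense_mem_topology\<close>).

  Conversely, it suffices, by minimality of the generated topology, that the dense sieves form a
  topology containing \<open>J\<close> (\<open>dense_topology\<close>, \<open>covering_dense\<close>). The axiom that needs an
  idea is stability under pullback (\<open>dense_pullback\<close>). There, closed sieves on the source
  of a morphism \<open>y\<close> are transported to its target by the right adjoint \<open>\<forall>\<^sub>y\<close> of \<open>y\<^sup>*\<close>. This
  preserves closedness (\<open>closed_forall_sieve\<close>) because coverings are stable under pullback, so that
  density of \<open>R\<close> can be applied to \<open>\<forall>\<^sub>y S\<close> whenever \<open>y\<^sup>*R \<subseteq> S\<close>.
\<close>

section \<open>Sieves and their pullbacks\<close>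

lemma pullback_mono: "S \<subseteq> S' \<Longrightarrow> pullback C x S \<subseteq> pullback C x S'"
  by (auto simp: pullback_def)

lemma in_pullback_iff:
  "x \<in> hom C X' X \<Longrightarrow> x' \<in> hom C X'' X' \<Longrightarrow> x' \<in> pullback C x S \<longleftrightarrow> Comp C x x' \<in> S"
  by (auto simp: pullback_def hom_def)

lemma pullback_domE:
  assumes "x' \<in> pullback C x S" and "x \<in> hom C X' X"
  obtains X'' where "x' \<in> hom C X'' X'" and "Comp C x x' \<in> S"
  using assms by (auto simp: pullback_def hom_def)

lemma sieve_subset_max: "is_sieve C X S \<Longrightarrow> S \<subseteq> max_sieve C X"
  by (auto simp: is_sieve_def max_sieve_def)

lemma sieve_homE:
  assumes "is_sieve C X S" and "x \<in> S"
  obtains X' where "x \<in> hom C X' X"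
  using assms by (auto simp: is_sieve_def hom_def)

lemma sieve_comp:
  "is_sieve C X S \<Longrightarrow> x \<in> S \<Longrightarrow> x \<in> hom C X' X \<Longrightarrow> x' \<in> hom C X'' X' \<Longrightarrow> Comp C x x' \<in> S"
  by (auto simp: is_sieve_def hom_def)

context category
begin

lemma hom_Obj: "f \<in> hom C X Y \<Longrightarrow> X \<in> Obj C" "f \<in> hom C X Y \<Longrightarrow> Y \<in> Obj C"
  using dom_in_Obj cod_in_Obj by (auto simp: hom_def)

lemma sieve_with_id_max:
  assumes "is_sieve C X S" and "Id C X \<in> S"
  shows "S = max_sieve C X"
proof
  show "max_sieve C X \<subseteq> S"
  proof
    fix x assume "x \<in> max_sieve C X"
    then have x: "x \<in> hom C (Dom C x) X"
      by (auto simp: max_sieve_def hom_def)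
    then have "Comp C (Id C X) x \<in> S"
      using sieve_comp[OF assms] id_in_hom hom_Obj by blast
    then show "x \<in> S"
      by (simp add: comp_id_left[OF x])
  qed
qed (rule sieve_subset_max[OF assms(1)])

lemma pullback_comp:
  assumes x: "x \<in> hom C X' X" and x': "x' \<in> hom C X'' X'"
  shows "pullback C x' (pullback C x S) = pullback C (Comp C x x') S"
proof (rule set_eqI)
  fix x''
  show "x'' \<in> pullback C x' (pullback C x S) \<longleftrightarrow> x'' \<in> pullback C (Comp C x x') S"
  proof (cases "x'' \<in> hom C (Dom C x'') X''")
    case True
    then show ?thesis
      using in_pullback_iff[OF x' True] in_pullback_iff[OF x comp_in_hom[OF True x']]
        in_pullback_iff[OF comp_in_hom[OF x' x] True] comp_assoc[OF True x' x] by simp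
  next
    case False
    then show ?thesis
      using x' comp_in_hom[OF x' x] by (auto simp: pullback_def hom_def)
  qed
qed

lemma pullback_id:
  assumes "is_sieve C X S"
  shows "pullback C (Id C X) S = S"
proof (rule set_eqI)
  fix x
  have id: "Id C X \<in> hom C X X"
    using assms id_in_hom by (simp add: is_sieve_def)
  show "x \<in> pullback C (Id C X) S \<longleftrightarrow> x \<in> S"
  proof (cases "x \<in> hom C (Dom C x) X")
    case True
    then show ?thesis
      by (simp add: in_pullback_iff[OF id True] comp_id_left[OF True])
  next
    case False
    then show ?thesis
      using assms id by (auto simp: pullback_def is_sieve_def hom_def)
  qed
qed

lemma id_in_pullback_iff:
  assumes x: "x \<in> hom C X' X"
  shows "Id C X' \<in> pullback C x S \<longleftrightarrow> x \<in> S"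
  using in_pullback_iff[OF x id_in_hom] hom_Obj[OF x] comp_id_right[OF x] by simp

lemma pullback_member_max:
  assumes "is_sieve C X S" and "x \<in> hom C X' X" and "x \<in> S"
  shows "pullback C x S = max_sieve C X'"
proof (rule sieve_with_id_max[OF is_sieve_pullback[OF assms(1,2)]])
  show "Id C X' \<in> pullback C x S"
    using id_in_pullback_iff[OF assms(2)] assms(3) by simp
qed

end


section \<open>The right adjoint of pullback\<close>

text \<open>The right adjoint \<open>\<forall>\<^sub>y\<close> of the pullback \<open>y\<^sup>*\<close> on sieves: the largest sieve \<open>R\<close> on \<open>Y\<close>
  with \<open>y\<^sup>*R \<subseteq> S\<close>. A morphism \<open>z\<close> belongs to it when the sieve generated by \<open>z\<close>, pulled back along
  \<open>y\<close>, lies in \<open>S\<close>.\<close>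

definition forall_sieve :: "('o, 'm) cat \<Rightarrow> 'm \<Rightarrow> 'o \<Rightarrow> 'm set \<Rightarrow> 'm set" where
  "forall_sieve C y Y S = {z \<in> max_sieve C Y.
     \<forall>W. \<forall>v \<in> hom C W (Dom C z). \<forall>w \<in> hom C W (Dom C y). Comp C z v = Comp C y w \<longrightarrow> w \<in> S}"

lemma in_forall_sieve_iff:
  "z \<in> hom C Z Y \<Longrightarrow> y \<in> hom C Y' Y \<Longrightarrow> z \<in> forall_sieve C y Y S \<longleftrightarrow>
     (\<forall>W. \<forall>v \<in> hom C W Z. \<forall>w \<in> hom C W Y'. Comp C z v = Comp C y w \<longrightarrow> w \<in> S)"
  by (auto simp: forall_sieve_def max_sieve_def hom_def)

context category
begin

lemma is_sieve_forall_sieve: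
  assumes y: "y \<in> hom C Y' Y"
  shows "is_sieve C Y (forall_sieve C y Y S)"
proof -
  have "Comp C z u \<in> forall_sieve C y Y S"
    if z: "z \<in> hom C Z Y" "z \<in> forall_sieve C y Y S" and u: "u \<in> hom C U Z" for z u Z U
    unfolding in_forall_sieve_iff[OF comp_in_hom[OF u z(1)] y]
  proof (intro allI ballI impI)
    fix W v w
    assume v: "v \<in> hom C W U" and w: "w \<in> hom C W Y'" "Comp C (Comp C z u) v = Comp C y w"
    have "Comp C z (Comp C u v) = Comp C y w"
      using comp_assoc[OF v u z(1)] w(2) by simp
    then show "w \<in> S"
      using z(2) comp_in_hom[OF v u] w(1) unfolding in_forall_sieve_iff[OF z(1) y] by blast
  qed
  moreover have "z \<in> Arr C \<and> Cod C z = Y" if "z \<in> forall_sieve C y Y S" for z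
    using that by (auto simp: forall_sieve_def max_sieve_def)
  ultimately show ?thesis
    using hom_Obj(2)[OF y] by (auto simp: is_sieve_def hom_def)
qed

lemma subset_forall_sieve:
  assumes y: "y \<in> hom C Y' Y" and R: "is_sieve C Y R" and sub: "pullback C y R \<subseteq> S"
  shows "R \<subseteq> forall_sieve C y Y S"
proof
  fix z assume zR: "z \<in> R"
  then obtain Z where z: "z \<in> hom C Z Y"
    using sieve_homE[OF R] by blast
  show "z \<in> forall_sieve C y Y S"
    unfolding in_forall_sieve_iff[OF z y]
  proof (intro allI ballI impI)
    fix W v w
    assume v: "v \<in> hom C W Z" and w: "w \<in> hom C W Y'" and "Comp C z v = Comp C y w"
    then have "Comp C y w \<in> R"
      using sieve_comp[OF R zR z v] by simp
    then show "w \<in> S"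
      using sub in_pullback_iff[OF y w] by blast
  qed
qed

lemma in_forall_sieveD:
  assumes y: "y \<in> hom C Y' Y" and w: "w \<in> hom C W Y'"
    and mem: "Comp C y w \<in> forall_sieve C y Y S"
  shows "w \<in> S"
proof -
  note yw = comp_in_hom[OF w y]
  have "Id C W \<in> hom C W W" "Comp C (Comp C y w) (Id C W) = Comp C y w"
    using id_in_hom hom_Obj(1)[OF w] comp_id_right[OF yw] by auto
  then show ?thesis
    using mem w unfolding in_forall_sieve_iff[OF yw y] by blast
qed

end


section \<open>Closed and dense sieves\<close>

definition dense_sieve ::
  "('o, 'm) cat \<Rightarrow> ('o \<times> 'm set) set \<Rightarrow> 'o \<Rightarrow> 'm set \<Rightarrow> bool" where
  "dense_sieve C J X S \<longleftrightarrow> is_sieve C X S \<and>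
     (\<forall>S'. is_sieve C X S' \<and> S \<subseteq> S' \<and> closed_sieve C J X S' \<longrightarrow> S' = max_sieve C X)"

lemma dense_sieveI:
  assumes "is_sieve C X S"
    and "\<And>S'. is_sieve C X S' \<Longrightarrow> S \<subseteq> S' \<Longrightarrow> closed_sieve C J X S' \<Longrightarrow> S' = max_sieve C X"
  shows "dense_sieve C J X S"
  using assms by (simp add: dense_sieve_def)

lemma dense_sieve_is_sieve: "dense_sieve C J X S \<Longrightarrow> is_sieve C X S"
  by (simp add: dense_sieve_def)

lemma dense_sieve_closed_max:
  "dense_sieve C J X S \<Longrightarrow> is_sieve C X S' \<Longrightarrow> S \<subseteq> S' \<Longrightarrow> closed_sieve C J X S' \<Longrightarrow>
     S' = max_sieve C X"
  by (simp add: dense_sieve_def)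

context category
begin

lemma closed_sieve_max: "closed_sieve C J X (max_sieve C X)"
  by (auto simp: closed_sieve_def max_sieve_def hom_def)

lemma closed_sieve_pullback:
  assumes S: "closed_sieve C J X S" and x: "x \<in> hom C X' X"
  shows "closed_sieve C J X' (pullback C x S)"
  unfolding closed_sieve_def
proof (intro allI ballI impI)
  fix X'' x' assume x': "x' \<in> hom C X'' X'" and "(X'', pullback C x' (pullback C x S)) \<in> J"
  then have "Comp C x x' \<in> S"
    using S comp_in_hom[OF x' x] by (simp add: pullback_comp[OF x x'] closed_sieve_def)
  then show "x' \<in> pullback C x S"
    by (simp add: in_pullback_iff[OF x x'])
qed

text \<open>If every pullback \<open>x\<^sup>*S'\<close> along \<open>x \<in> S\<close> is dense, then every closed sieve containing
  \<open>S'\<close> contains \<open>S\<close>, since its pullbacks along the members of \<open>S\<close> are closed, hence maximal.\<close>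

lemma dense_transitive:
  assumes S: "dense_sieve C J X S" and S': "is_sieve C X S'"
    and loc: "\<And>x X'. x \<in> S \<Longrightarrow> x \<in> hom C X' X \<Longrightarrow> dense_sieve C J X' (pullback C x S')"
  shows "dense_sieve C J X S'"
proof -
  have sS: "is_sieve C X S"
    using S by (rule dense_sieve_is_sieve)
  show ?thesis
  proof (rule dense_sieveI[OF S'])
    fix R assume R: "is_sieve C X R" "S' \<subseteq> R" "closed_sieve C J X R"
    have "S \<subseteq> R"
    proof
      fix x assume xS: "x \<in> S"
      then obtain X' where x: "x \<in> hom C X' X"
        using sieve_homE[OF sS] by blast
      have "pullback C x R = max_sieve C X'"
        by (rule dense_sieve_closed_max[OF loc[OF xS x] is_sieve_pullback[OF R(1) x]
              pullback_mono[OF R(2)] closed_sieve_pullback[OF R(3) x]])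
      moreover have "Id C X' \<in> max_sieve C X'"
        using id_in_hom hom_Obj(1)[OF x] by (auto simp: max_sieve_def hom_def)
      ultimately show "x \<in> R"
        using id_in_pullback_iff[OF x, of R] by simp
    qed
    then show "R = max_sieve C X"
      using dense_sieve_closed_max[OF S R(1)] R(3) by simp
  qed
qed

text \<open>The sieve of those \<open>x\<close> along which \<open>S\<close> pulls back into a topology \<open>T\<close> is the closure of
  \<open>S\<close> for \<open>T\<close>. It is closed for every \<open>J \<subseteq> T\<close>, which makes \<open>S\<close> a member of \<open>T\<close> as soon as \<open>S\<close> is
  dense for \<open>J\<close>.\<close>

lemma dense_mem_topology:
  assumes T: "grothendieck_topology C T" and J: "J \<subseteq> T" and S: "dense_sieve C J X S"
  shows "(X, S) \<in> T"
proof -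
  define R where "R = {x \<in> max_sieve C X. (Dom C x, pullback C x S) \<in> T}"
  have sS: "is_sieve C X S"
    using S by (rule dense_sieve_is_sieve)
  then have X: "X \<in> Obj C"
    by (simp add: is_sieve_def)
  have R_iff: "x \<in> R \<longleftrightarrow> (X', pullback C x S) \<in> T" if "x \<in> hom C X' X" for x X'
    using that by (auto simp: R_def max_sieve_def hom_def)
  have T_pull: "(X', pullback C x P) \<in> T" if "(Y, P) \<in> T" "x \<in> hom C X' Y" for Y P x X'
    using T that unfolding grothendieck_topology_def by blast
  have sR: "is_sieve C X R"
  proof -
    have "Comp C x x' \<in> R" if x: "x \<in> hom C X' X" "x \<in> R" and x': "x' \<in> hom C X'' X'"
      for x x' X' X''
      using T_pull[OF _ x', of "pullback C x S"] x R_iff[OF x(1)]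
        R_iff[OF comp_in_hom[OF x' x(1)]] pullback_comp[OF x(1) x'] by simp
    moreover have "x \<in> Arr C \<and> Cod C x = X" if "x \<in> R" for x
      using that by (auto simp: R_def max_sieve_def)
    ultimately show ?thesis
      using X by (auto simp: is_sieve_def hom_def)
  qed
  have "S \<subseteq> R"
  proof
    fix x assume xS: "x \<in> S"
    then obtain X' where x: "x \<in> hom C X' X"
      using sieve_homE[OF sS] by blast
    have "(X', max_sieve C X') \<in> T"
      using T hom_Obj(1)[OF x] unfolding grothendieck_topology_def by blast
    then show "x \<in> R"
      using R_iff[OF x] pullback_member_max[OF sS x xS] by simp
  qed
  moreover have "closed_sieve C J X R"
    unfolding closed_sieve_def
  proof (intro allI ballI impI)
    fix X' x assume x: "x \<in> hom C X' X" and "(X', pullback C x R) \<in> J"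
    then have cov: "(X', pullback C x R) \<in> T"
      using J by blast
    have "(Dom C x', pullback C x' (pullback C x S)) \<in> T" if x'R: "x' \<in> pullback C x R" for x'
    proof -
      obtain X'' where x': "x' \<in> hom C X'' X'" and "Comp C x x' \<in> R"
        using pullback_domE[OF x'R x] by blast
      then have "(X'', pullback C (Comp C x x') S) \<in> T"
        using R_iff[OF comp_in_hom[OF x' x]] by blast
      then show ?thesis
        using x' pullback_comp[OF x x'] by (simp add: hom_def)
    qed
    then have "(X', pullback C x S) \<in> T"
      using T cov is_sieve_pullback[OF sS x] unfolding grothendieck_topology_def by blast
    then show "x \<in> R"
      by (simp add: R_iff[OF x])
  qed
  ultimately have "R = max_sieve C X"
    by (rule dense_sieve_closed_max[OF S sR])
  moreover have id: "Id C X \<in> hom C X X"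
    by (rule id_in_hom[OF X])
  ultimately have "Id C X \<in> R"
    by (auto simp: max_sieve_def hom_def)
  then show ?thesis
    by (simp add: R_iff[OF id] pullback_id[OF sS])
qed

end


section \<open>The topology of dense sieves\<close>

locale stable_coverings = category +
  fixes J
  assumes covering_sieves: "J \<subseteq> sieves C"
    and covering_up: "(Y, R) \<in> J \<Longrightarrow> is_sieve C Y R' \<Longrightarrow> R \<subseteq> R' \<Longrightarrow> (Y, R') \<in> J"
    and covering_pullback: "y \<in> hom C Y' Y \<Longrightarrow> (Y, R) \<in> J \<Longrightarrow> (Y', pullback C y R) \<in> J"
begin

text \<open>A closed sieve containing a covering one is itself covering, hence so are all its pullbacks,
  and closedness puts every morphism into it.\<close>

lemma covering_dense:
  assumes "(Y, R) \<in> J"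
  shows "dense_sieve C J Y R"
proof (rule dense_sieveI)
  show "is_sieve C Y R"
    using assms covering_sieves by (auto simp: sieves_def)
  show "R' = max_sieve C Y"
    if R': "is_sieve C Y R'" "R \<subseteq> R'" "closed_sieve C J Y R'" for R'
  proof -
    have "(Y, R') \<in> J"
      by (rule covering_up[OF assms R'(1,2)])
    then have "x \<in> R'" if "x \<in> hom C X' Y" for x X'
      using covering_pullback that R'(3) unfolding closed_sieve_def by blast
    then have "max_sieve C Y \<subseteq> R'"
      by (auto simp: max_sieve_def hom_def)
    then show ?thesis
      using sieve_subset_max[OF R'(1)] by blast
  qed
qed

text \<open>Suppose \<open>z\<^sup>*(\<forall>\<^sub>y S)\<close> is covering and \<open>z \<circ> v = y \<circ> w\<close>. Pulling back further along \<open>v\<close> shows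
  that \<open>(y \<circ> w)\<^sup>*(\<forall>\<^sub>y S)\<close> is covering; this sieve lies in \<open>w\<^sup>*S\<close>, and closedness of \<open>S\<close> gives
  \<open>w \<in> S\<close>.\<close>

lemma closed_forall_sieve:
  assumes y: "y \<in> hom C Y' Y" and S: "is_sieve C Y' S" "closed_sieve C J Y' S"
  shows "closed_sieve C J Y (forall_sieve C y Y S)"
  unfolding closed_sieve_def
proof (intro allI ballI impI)
  let ?F = "forall_sieve C y Y S"
  fix Z z assume z: "z \<in> hom C Z Y" and cov: "(Z, pullback C z ?F) \<in> J"
  show "z \<in> ?F"
    unfolding in_forall_sieve_iff[OF z y]
  proof (intro allI ballI impI)
    fix W v w
    assume v: "v \<in> hom C W Z" and w: "w \<in> hom C W Y'" and eq: "Comp C z v = Comp C y w"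
    have "(W, pullback C (Comp C y w) ?F) \<in> J"
      using covering_pullback[OF v cov] pullback_comp[OF z v] eq by simp
    moreover have "pullback C (Comp C y w) ?F \<subseteq> pullback C w S"
    proof
      fix u assume "u \<in> pullback C (Comp C y w) ?F"
      then obtain U where u: "u \<in> hom C U W" and "Comp C (Comp C y w) u \<in> ?F"
        using pullback_domE[OF _ comp_in_hom[OF w y]] by blast
      then have "Comp C w u \<in> S"
        using in_forall_sieveD[OF y comp_in_hom[OF u w]] comp_assoc[OF u w y] by simp
      then show "u \<in> pullback C w S"
        by (simp add: in_pullback_iff[OF w u])
    qed
    ultimately have "(W, pullback C w S) \<in> J"
      using covering_up is_sieve_pullback[OF S(1) w] by blast
    then show "w \<in> S"
      using S(2) w unfolding closed_sieve_def by blast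
  qed
qed

lemma dense_pullback:
  assumes R: "dense_sieve C J Y R" and y: "y \<in> hom C Y' Y"
  shows "dense_sieve C J Y' (pullback C y R)"
proof -
  have sR: "is_sieve C Y R"
    using R by (rule dense_sieve_is_sieve)
  show ?thesis
  proof (rule dense_sieveI[OF is_sieve_pullback[OF sR y]])
    fix S assume S: "is_sieve C Y' S" "pullback C y R \<subseteq> S" "closed_sieve C J Y' S"
    have "forall_sieve C y Y S = max_sieve C Y"
      by (rule dense_sieve_closed_max[OF R is_sieve_forall_sieve[OF y]
            subset_forall_sieve[OF y sR S(2)] closed_forall_sieve[OF y S(1,3)]])
    then have "Comp C y (Id C Y') \<in> forall_sieve C y Y S"
      using y comp_id_right[OF y] by (auto simp: max_sieve_def hom_def)
    then have "Id C Y' \<in> S"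
      using in_forall_sieveD[OF y id_in_hom] hom_Obj(1)[OF y] by blast
    then show "S = max_sieve C Y'"
      by (rule sieve_with_id_max[OF S(1)])
  qed
qed

lemma dense_topology: "grothendieck_topology C {(Y, R). dense_sieve C J Y R}"
proof -
  have "dense_sieve C J Y (max_sieve C Y)" if "Y \<in> Obj C" for Y
    by (rule dense_sieveI[OF is_sieve_max[OF that]]) (simp add: equalityI sieve_subset_max)
  moreover have "dense_sieve C J Y R'"
    if R: "dense_sieve C J Y R" and R': "is_sieve C Y R'"
      and loc: "\<forall>y \<in> R. dense_sieve C J (Dom C y) (pullback C y R')" for Y R R'
    using dense_transitive[OF R R'] loc by (auto simp: hom_def)
  moreover have "{(Y, R). dense_sieve C J Y R} \<subseteq> sieves C"
    by (auto simp: dense_sieve_def sieves_def)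
  ultimately show ?thesis
    unfolding grothendieck_topology_def mem_Collect_eq case_prod_conv
    by (intro conjI allI ballI impI) (assumption | rule dense_pullback)+
qed

theorem generated_iff_dense:
  "(X, S) \<in> generated_topology C J \<longleftrightarrow> dense_sieve C J X S"
proof
  assume "(X, S) \<in> generated_topology C J"
  moreover have "J \<subseteq> {(Y, R). dense_sieve C J Y R}"
    using covering_dense by auto
  ultimately show "dense_sieve C J X S"
    using generated_topology_least[OF dense_topology] by blast
next
  assume "dense_sieve C J X S"
  then show "(X, S) \<in> generated_topology C J"
    by (rule dense_mem_topology[OF grothendieck_topology_generated[OF covering_sieves]
          generated_topology_contains])
qed

end

theorem mainTheorem9:
  fixes C :: "('o, 'm) cat"
    and J :: "('o \<times> 'm set) set"
    and X :: 'o
    and S :: "'m set"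
  assumes "category C"
    and "essentially_small TYPE('u) C"
    and "J \<subseteq> sieves C"
    and "\<And>Y R R'. (Y, R) \<in> J \<Longrightarrow> is_sieve C Y R' \<Longrightarrow> R \<subseteq> R' \<Longrightarrow> (Y, R') \<in> J"
    and "\<And>Y. Y \<in> Obj C \<Longrightarrow> (Y, max_sieve C Y) \<in> J"
    and "\<And>Y Y' y R. y \<in> hom C Y' Y \<Longrightarrow> (Y, R) \<in> J \<Longrightarrow> (Y', pullback C y R) \<in> J"
    and "is_sieve C X S"
  shows "(X, S) \<in> generated_topology C J \<longleftrightarrow>
    (is_sieve C X (max_sieve C X) \<and> S \<subseteq> max_sieve C X \<and> closed_sieve C J X (max_sieve C X)) \<and>
    (\<forall>S'. is_sieve C X S' \<and> S \<subseteq> S' \<and> closed_sieve C J X S' \<longrightarrow> S' = max_sieve C X)"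
proof -
  interpret stable_coverings C J
    using assms(1,3,4,6) by (simp add: stable_coverings_def stable_coverings_axioms_def)
  have "X \<in> Obj C"
    using assms(7) by (simp add: is_sieve_def)
  then show ?thesis
    by (simp add: generated_iff_dense dense_sieve_def assms(7) is_sieve_max closed_sieve_max
        sieve_subset_max[OF assms(7)])
qed

end
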